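(* If $n$ is a positive integer and $p$, $q$ and $t$ are any integers, then $$\sum_{k=1}^n(-1)^{q(n-k)}\frac{k}{n+k}\binom{n+k}{n-k}F_p^{n-k}F_{p+q}^{n-k}F_q^{2k-1}L_{(2p+q)k+t}=\frac{F_{p+q}^{2n}\bigl(F_{p+q}L_{p+t+qn}+F_pL_{q+p+t+qn}\bigr)-F_p^{2n}\bigl(F_{p+q}L_{p+t-qn}+F_pL_{q+p+t-qn}\bigr)}{2\bigl(F_{p+q}^2+F_pF_{p+q}L_q+(-1)^qF_p^2\bigr)},$$ $$\sum_{k=1}^n(-1)^{q(n-k)}\frac{k}{n+k}\binom{n+k}{n-k}F_p^{n-k}F_{p+q}^{n-k}F_q^{2k-1}F_{(2p+q)k+t}=\frac{F_{p+q}^{2n}\bigl(F_{p+q}F_{p+t+qn}+F_pF_{q+p+t+qn}\bigr)-F_p^{2n}\bigl(F_{p+q}F_{p+t-qn}+F_pF_{p+q+t-qn}\bigr)}{2\bigl(F_{p+q}^2+F_pF_{p+q}L_q+(-1)^qF_p^2\bigr)},$$ $$\sum_{k=1}^n(-1)^{q(n-k)}\frac{k}{n+k}\binom{n+k}{n-k}L_p^{n-k}L_{p+q}^{n-k}F_q^{2k-1}5^kF_{(2p+q)k+t}=\frac{L_{p+q}^{2n}\bigl(L_{p+q}L_{p+t+qn}+L_pL_{q+p+t+qn}\bigr)-L_p^{2n}\bigl(L_{p+q}L_{p+t-qn}+L_pL_{p+q+t-qn}\bigr)}{2\bigl(L_{p+q}^2+L_pL_{p+q}L_q+(-1)^qL_p^2\bigr)},$$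 $$\sum_{k=1}^n(-1)^{q(n-k)}\frac{k}{n+k}\binom{n+k}{n-k}L_p^{n-k}L_{p+q}^{n-k}F_q^{2k-1}5^{k-1}L_{(2p+q)k+t}=\frac{L_{p+q}^{2n}\bigl(L_{p+q}F_{qn+p+t}+L_pF_{q+p+t+qn}\bigr)-L_p^{2n}\bigl(L_{p+q}F_{p+t-qn}+L_pF_{p+q+t-qn}\bigr)}{2\bigl(L_{p+q}^2+L_pL_{p+q}L_q+(-1)^qL_p^2\bigr)}.$$
   Context: $F_n$ and $L_n$ ($n\in\mathbb{Z}$) are the Fibonacci and Lucas numbers: $F_0=0$, $F_1=1$, $F_n=F_{n-1}+F_{n-2}$; $L_0=2$, $L_1=1$, $L_n=L_{n-1}+L_{n-2}$, extended to negative indices by $F_{-n}=(-1)^{n-1}F_n$, $L_{-n}=(-1)^nL_n$. *)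

theory Defs
  imports Complex_Main "HOL-Number_Theory.Fib"
begin

definition fib_int :: "int \<Rightarrow> int" where
  "fib_int n = (if n \<ge> 0 then int (fib (nat n))
                else (-1) ^ (nat (- n) - 1) * int (fib (nat (- n))))"

fun lucas :: "nat \<Rightarrow> nat" where
  "lucas 0 = 2"
| "lucas (Suc 0) = 1"
| "lucas (Suc (Suc n)) = lucas (Suc n) + lucas n"

definition lucas_int :: "int \<Rightarrow> int" where
  "lucas_int n = (if n \<ge> 0 then int (lucas (nat n))
                  else (-1) ^ nat (- n) * int (lucas (nat (- n))))"

abbreviation F :: "int \<Rightarrow> real" where "F n \<equiv> real_of_int (fib_int n)"
abbreviation L :: "int \<Rightarrow> real" where "L n \<equiv> real_of_int (lucas_int n)"

lemma fib_int_rec: "fib_int n = fib_int (n - 1) + fib_int (n - 2)"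
proof -
  consider m where "n = int m + 2" | "n = 1" | "n = 0" | m where "n = - int m - 1"
  proof -
    have "n = int (nat (n - 2)) + 2 \<or> n = 1 \<or> n = 0 \<or> n = - int (nat (- n - 1)) - 1"
      by linarith
    then show ?thesis using that by blast
  qed
  then show ?thesis
  proof cases
    case (1 m)
    then have "nat n = Suc (Suc m)" "nat (n - 1) = Suc m" "nat (n - 2) = m" by auto
    then show ?thesis using 1 by (simp add: fib_int_def)
  next
    case (4 m)
    then have "nat (- n) = Suc m" "nat (- (n - 1)) = Suc (Suc m)"
      "nat (- (n - 2)) = Suc (Suc (Suc m))" by auto
    moreover have "n < 0" using 4 by simp
    ultimately show ?thesis by (simp add: fib_int_def algebra_simps)
  qed (simp_all add: fib_int_def numeral_2_eq_2)
qed

lemma lucas_int_rec: "lucas_int n = lucas_int (n - 1) + lucas_int (n - 2)"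
proof -
  consider m where "n = int m + 2" | "n = 1" | "n = 0" | m where "n = - int m - 1"
  proof -
    have "n = int (nat (n - 2)) + 2 \<or> n = 1 \<or> n = 0 \<or> n = - int (nat (- n - 1)) - 1"
      by linarith
    then show ?thesis using that by blast
  qed
  then show ?thesis
  proof cases
    case (1 m)
    then have "nat n = Suc (Suc m)" "nat (n - 1) = Suc m" "nat (n - 2) = m" by auto
    then show ?thesis using 1 by (simp add: lucas_int_def)
  next
    case (4 m)
    then have "nat (- n) = Suc m" "nat (- (n - 1)) = Suc (Suc m)"
      "nat (- (n - 2)) = Suc (Suc (Suc m))" by auto
    moreover have "n < 0" using 4 by simp
    ultimately show ?thesis by (simp add: lucas_int_def algebra_simps)
  qed (simp_all add: lucas_int_def numeral_2_eq_2)
qed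

end

(* With alpha, beta the roots of z^2 = z + 1, Binet's formula gives
     alpha^p F_q = F_{p+q} - beta^q F_p   and   sqrt 5 alpha^p F_q = L_{p+q} - beta^q L_p.
   Replacing the last factor L_m or F_m of the summand by alpha^m and putting x = F_{p+q}
   (or L_{p+q}) and y = beta^q F_p (or beta^q L_p), each sum becomes a multiple of
     sum k/(n+k) binom(n+k,n-k) (xy)^(n-k) (x-y)^(2k-1) = (x^(2n) - y^(2n)) / (2(x+y)),
   and the denominator is rationalised by the conjugate of x + y. Exchanging alpha and beta
   replaces sqrt 5 by -sqrt 5; linear combinations of the two versions give all four formulas. *)
theory Submission
  imports Defs "HOL-Computational_Algebra.Primes"
begin

section \<open>The polynomial identity behind the weighted binomial sum\<close>

text \<open>By symmetry the lower index becomes 2k, and absorption then cancels the rational weight.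
  What remains is a plain binomial coefficient, open to Pascal's rule.\<close>

lemma weighted_choose_eq:
  assumes "0 < k" "k \<le> n"
  shows "real k / real (n + k) * real ((n + k) choose (n - k)) = real ((n + k - 1) choose (2 * k - 1)) / 2"
proof -
  obtain j where k: "k = Suc j" using assms gr0_implies_Suc by blast
  have "(n + k) choose (n - k) = (n + k) choose (2 * k)"
    using assms binomial_symmetric[of "n - k" "n + k"] by (simp add: mult_2)
  moreover have "real (2 * k) * real ((n + k) choose (2 * k)) = real (n + k) * real ((n + k - 1) choose (2 * k - 1))"
    using binomial_absorption[of "2 * j + 1" "n + k"] k
    by (metis (no_types, lifting) Suc_eq_plus1 add_Suc_right diff_Suc_1 mult_2 of_nat_mult add_Suc)
  ultimately show ?thesis using assms by (simp add: field_simps)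
qed

text \<open>The two sums are proved together because Pascal's rule turns each into a combination of the
  other: u (n + 1) = m u n + d v n and v (n + 1) = m v n + d u (n + 1).\<close>
lemma sum_choose_odd_even:
  fixes x y :: real
  defines "d \<equiv> x - y" and "m \<equiv> x * y"
  shows "(x + y) * (\<Sum>k<n. real ((n + k) choose (2 * k + 1)) * m ^ (n - 1 - k) * d ^ (2 * k + 1)) = x ^ (2 * n) - y ^ (2 * n)"
    and "(x + y) * (\<Sum>k\<le>n. real ((n + k) choose (2 * k)) * m ^ (n - k) * d ^ (2 * k)) = x ^ (2 * n + 1) + y ^ (2 * n + 1)"
proof -
  define u where "u n = (\<Sum>k<n. real ((n + k) choose (2 * k + 1)) * m ^ (n - 1 - k) * d ^ (2 * k + 1))" for n
  define v where "v n = (\<Sum>k\<le>n. real ((n + k) choose (2 * k)) * m ^ (n - k) * d ^ (2 * k))" for n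
  have u_Suc: "u (Suc n) = m * u n + d * v n" for n
  proof -
    have "m * u n = (\<Sum>k<n. real ((n + k) choose (2 * k + 1)) * m ^ (n - k) * d ^ (2 * k + 1))"
      unfolding u_def sum_distrib_left
    proof (rule sum.cong[OF refl])
      fix k assume "k \<in> {..<n}"
      then have "m ^ (n - k) = m * m ^ (n - 1 - k)"
        by (metis Suc_diff_Suc diff_Suc_eq_diff_pred lessThan_iff power_Suc)
      then show "m * (real ((n + k) choose (2 * k + 1)) * m ^ (n - 1 - k) * d ^ (2 * k + 1))
        = real ((n + k) choose (2 * k + 1)) * m ^ (n - k) * d ^ (2 * k + 1)" by simp
    qed
    \<comment> \<open>The added term k = n contains binom(2n, 2n+1) = 0. Both sums now have the
      range of \<open>v n\<close>, so Pascal's rule applies term by term.\<close>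
    also have "\<dots> = (\<Sum>k\<le>n. real ((n + k) choose (2 * k + 1)) * m ^ (n - k) * d ^ (2 * k + 1))"
      by (simp add: lessThan_Suc_atMost[symmetric] binomial_eq_0)
    finally show ?thesis
      unfolding u_def v_def
      by (simp add: sum_distrib_left sum.distrib[symmetric] lessThan_Suc_atMost algebra_simps)
  qed
  have v_Suc: "v (Suc n) = m * v n + d * u (Suc n)" for n
  proof -
    have "m * v n = (\<Sum>k\<le>n. real ((n + k) choose (2 * k)) * m ^ (Suc n - k) * d ^ (2 * k))"
      unfolding v_def sum_distrib_left by (rule sum.cong) (auto simp: Suc_diff_le)
    \<comment> \<open>The added term k = n + 1 contains binom(2n+1, 2n+2) = 0. Afterwards the term k
      = 0 is split off, since it equals m^(n+1) here and in \<open>v (Suc n)\<close> alike, and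
      Pascal's rule handles the rest.\<close>
    also have "\<dots> = (\<Sum>k\<le>Suc n. real ((n + k) choose (2 * k)) * m ^ (Suc n - k) * d ^ (2 * k))"
      by (simp add: binomial_eq_0)
    also have "\<dots> = m ^ Suc n + (\<Sum>k\<le>n. real ((n + Suc k) choose (2 * Suc k)) * m ^ (n - k) * d ^ (2 * Suc k))"
      by (subst sum.atMost_Suc_shift) simp
    finally have mv: "m * v n = \<dots>" .
    have "v (Suc n) = m ^ Suc n + (\<Sum>k\<le>n. real ((Suc n + Suc k) choose (2 * Suc k)) * m ^ (n - k) * d ^ (2 * Suc k))"
      unfolding v_def by (subst sum.atMost_Suc_shift) simp
    then show ?thesis
      unfolding mv u_def
      by (simp add: sum_distrib_left sum.distrib[symmetric] lessThan_Suc_atMost algebra_simps)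
  qed
  have "(x + y) * u n = x ^ (2 * n) - y ^ (2 * n) \<and> (x + y) * v n = x ^ (2 * n + 1) + y ^ (2 * n + 1)"
  proof (induction n)
    case 0
    then show ?case by (simp add: u_def v_def)
  next
    case (Suc n)
    have "(x + y) * u (Suc n) = m * ((x + y) * u n) + d * ((x + y) * v n)"
      by (simp add: u_Suc algebra_simps)
    also have "\<dots> = x ^ (2 * Suc n) - y ^ (2 * Suc n)"
      unfolding Suc[THEN conjunct1] Suc[THEN conjunct2] by (simp add: m_def d_def algebra_simps)
    finally have u: "(x + y) * u (Suc n) = \<dots>" .
    have "(x + y) * v (Suc n) = m * ((x + y) * v n) + d * ((x + y) * u (Suc n))"
      by (simp add: v_Suc algebra_simps)
    also have "\<dots> = x ^ (2 * Suc n + 1) + y ^ (2 * Suc n + 1)"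
      unfolding Suc[THEN conjunct2] u by (simp add: m_def d_def algebra_simps)
    finally show ?case using u by simp
  qed
  then show "(x + y) * (\<Sum>k<n. real ((n + k) choose (2 * k + 1)) * m ^ (n - 1 - k) * d ^ (2 * k + 1)) = x ^ (2 * n) - y ^ (2 * n)"
    and "(x + y) * (\<Sum>k\<le>n. real ((n + k) choose (2 * k)) * m ^ (n - k) * d ^ (2 * k)) = x ^ (2 * n + 1) + y ^ (2 * n + 1)"
    by (auto simp: u_def v_def)
qed

lemma sum_weighted_choose:
  fixes x y :: real
  shows "2 * (x + y) * (\<Sum>k=1..n. real k / real (n + k) * real ((n + k) choose (n - k))
           * (x * y) ^ (n - k) * (x - y) ^ (2 * k - 1)) = x ^ (2 * n) - y ^ (2 * n)"
    (is "2 * (x + y) * ?S = _")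
proof -
  have "(\<Sum>k=1..n. real k / real (n + k) * real ((n + k) choose (n - k))
           * (x * y) ^ (n - k) * (x - y) ^ (2 * k - 1))
    = (\<Sum>k=1..n. real ((n + k - 1) choose (2 * k - 1)) / 2 * (x * y) ^ (n - k) * (x - y) ^ (2 * k - 1))"
    by (rule sum.cong) (simp_all only: weighted_choose_eq atLeastAtMost_iff One_nat_def Suc_le_eq)
  \<comment> \<open>Shifting k to k + 1 gives the odd-index sum of
    \<open>sum_choose_odd_even\<close>.\<close>
  also have "\<dots> = (\<Sum>k<n. real ((n + k) choose (2 * k + 1)) / 2 * (x * y) ^ (n - 1 - k) * (x - y) ^ (2 * k + 1))"
    unfolding One_nat_def sum.atLeast1_atMost_eq by simp
  also have "\<dots> = (\<Sum>k<n. real ((n + k) choose (2 * k + 1)) * (x * y) ^ (n - 1 - k) * (x - y) ^ (2 * k + 1)) / 2"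
    by (simp add: sum_divide_distrib)
  finally have "2 * (x + y) * ?S = (x + y) * (\<Sum>k<n. real ((n + k) choose (2 * k + 1)) * (x * y) ^ (n - 1 - k) * (x - y) ^ (2 * k + 1))"
    by (simp only: times_divide_eq_right mult.assoc)
  then show ?thesis unfolding sum_choose_odd_even(1) .
qed

section \<open>Substitution and rationalisation of the denominator\<close>

text \<open>Pure algebra with integer exponents abstracted away: A, B, P, T stand for alpha^q,
  beta^q, alpha^p, alpha^t, or for their conjugates, and f for F_q. The assumption \<open>D0\<close>
  ensures that a zero denominator, which does occur for p = q = 0 in the Fibonacci formulas, forces
  the sum to be zero too.\<close>

lemma sum_weighted_choose_power:
  fixes A B P T X Y e f :: real
  assumes AB: "(A * B)\<^sup>2 = 1" and d: "X - B * Y = e * P * f" and e: "e \<noteq> 0" 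
    and D0: "(X + A * Y) * (X + B * Y) = 0 \<Longrightarrow> f = 0"
  shows "e * (\<Sum>k=1..n. (A * B) ^ (n - k) * (real k / real (n + k)) * real ((n + k) choose (n - k))
            * Y ^ (n - k) * X ^ (n - k) * f ^ (2 * k - 1) * (e\<^sup>2) ^ (k - 1) * (P ^ (2 * k) * A ^ k * T))
    = (X ^ (2 * n) * (X * (P * T * A ^ n) + Y * (A * P * T * A ^ n))
       - Y ^ (2 * n) * (X * (P * T / A ^ n) + Y * (A * P * T / A ^ n)))
      / (2 * ((X + A * Y) * (X + B * Y)))" (is "e * ?S = ?N / (2 * ?D)")
proof -
  have A: "A \<noteq> 0" using AB by auto
  define c where "c k = real k / real (n + k) * real ((n + k) choose (n - k))" for k
  \<comment> \<open>Since e (e^2)^(k-1) = e^(2k-1), one factor P can be split off to leave (e P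
    f)^(2k-1), the odd power of X - B Y. Likewise (A B)^(n-k) A^k = A^n B^(n-k).\<close>
  have S: "e * ?S = P * T * A ^ n * (\<Sum>k=1..n. c k * (X * (B * Y)) ^ (n - k) * (X - B * Y) ^ (2 * k - 1))"
    unfolding sum_distrib_left
  proof (rule sum.cong[OF refl])
    fix k assume "k \<in> {1..n}"
    then obtain j i where k: "k = Suc j" and n: "n = i + k"
      by (metis Suc_le_D atLeastAtMost_iff le_Suc_ex add.commute One_nat_def)
    have nk: "n - k = i" using n by simp
    have 1: "2 * k = 2 * j + 2" "2 * k - 1 = 2 * j + 1" "k - 1 = j" "A ^ k = A * A ^ j" "A ^ n = A ^ i * A ^ k"
      using k n by (simp_all add: power_add)
    show "e * ((A * B) ^ (n - k) * (real k / real (n + k)) * real ((n + k) choose (n - k))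
            * Y ^ (n - k) * X ^ (n - k) * f ^ (2 * k - 1) * (e\<^sup>2) ^ (k - 1) * (P ^ (2 * k) * A ^ k * T))
       = P * T * A ^ n * (c k * (X * (B * Y)) ^ (n - k) * (X - B * Y) ^ (2 * k - 1))"
      unfolding d c_def nk 1
      by (simp add: power_mult_distrib power_add power_mult power2_eq_square mult_ac)
  qed
  \<comment> \<open>As (A B)^2 = 1, B^(2n) A^n is A^(-n). This is the source of the indices with -qn
    in the second half of the numerator.\<close>
  have BA: "(B * Y) ^ (2 * n) * A ^ n = Y ^ (2 * n) / A ^ n"
  proof -
    have "(B * Y) ^ (2 * n) * A ^ n * A ^ n = ((A * B)\<^sup>2) ^ n * Y ^ (2 * n)"
      by (simp add: power_mult_distrib power_mult power2_eq_square mult_ac)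
    then have "(B * Y) ^ (2 * n) * A ^ n * A ^ n = Y ^ (2 * n)" by (simp only: AB power_one mult_1)
    then show ?thesis using A by (simp add: eq_divide_eq)
  qed
  \<comment> \<open>The numerator contains the conjugate factor X + A Y, which cancels against the
    same factor of the denominator.\<close>
  have "?N = P * T * (X + A * Y) * (X ^ (2 * n) * A ^ n - Y ^ (2 * n) / A ^ n)"
    by (simp add: algebra_simps)
  also have "\<dots> = P * T * (X + A * Y) * (A ^ n * (X ^ (2 * n) - (B * Y) ^ (2 * n)))"
    unfolding BA[symmetric] by (simp add: algebra_simps)
  finally have N: "?N = \<dots>" .
  show ?thesis
  proof (cases "?D = 0")
    case True
    \<comment> \<open>The quotient is 0 by convention. The sum agrees: all exponents 2k - 1 are
      positive, so every term vanishes with X - B Y.\<close>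
    then have "X = B * Y" using D0 d by simp
    moreover have "(\<Sum>k=1..n. c k * (X * (B * Y)) ^ (n - k) * (X - B * Y) ^ (2 * k - 1)) = 0"
      using calculation by (intro sum.neutral) simp
    ultimately show ?thesis unfolding S N by simp
  next
    case False
    define \<sigma> where "\<sigma> = (\<Sum>k=1..n. c k * (X * (B * Y)) ^ (n - k) * (X - B * Y) ^ (2 * k - 1))"
    have "X ^ (2 * n) - (B * Y) ^ (2 * n) = 2 * (X + B * Y) * \<sigma>"
      unfolding \<sigma>_def c_def by (rule sum_weighted_choose[symmetric])
    with False show ?thesis
      unfolding S N \<sigma>_def[symmetric] by (simp add: eq_divide_eq mult_ac)
  qed
qed

text \<open>For nonzero y the exponent of 5 would be even on the left and odd on the right. This
  irrationality of the square root of 5 controls the zeros of the denominator.\<close>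

lemma int_square_eq_5_square:
  fixes x y :: int
  assumes "x\<^sup>2 = 5 * y\<^sup>2"
  shows "y = 0"
proof (rule ccontr)
  assume y: "y \<noteq> 0"
  then have x: "x \<noteq> 0" using assms by auto
  have p: "prime (5::int)" by simp
  have "2 * multiplicity 5 x = multiplicity 5 (x\<^sup>2)"
    using p x by (simp add: prime_elem_multiplicity_power_distrib)
  also have "\<dots> = 1 + 2 * multiplicity 5 y"
    unfolding assms using p y
    by (simp add: prime_elem_multiplicity_power_distrib prime_elem_multiplicity_mult_distrib)
  finally show False by presburger
qed

section \<open>Binet's formula and powers with integer exponents\<close>

lemma fib_recurrence_unique:
  fixes g h :: "int \<Rightarrow> 'a::ab_group_add"
  assumes g: "\<And>n. g n = g (n - 1) + g (n - 2)" and h: "\<And>n. h n = h (n - 1) + h (n - 2)"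
    and "g 0 = h 0" "g 1 = h 1"
  shows "g n = h n"
proof -
  \<comment> \<open>Two consecutive values determine both the next and the previous one, so the
    induction runs in both directions.\<close>
  have "g n = h n \<and> g (n + 1) = h (n + 1)"
  proof (induction n rule: int_induct[where k = 0])
    case base
    then show ?case using assms(3,4) by simp
  next
    case (step1 i)
    then show ?case using g[of "i + 2"] h[of "i + 2"] by (simp add: algebra_simps)
  next
    case (step2 i)
    then show ?case using g[of "i + 1"] h[of "i + 1"] by (simp add: algebra_simps)
  qed
  then show ?thesis ..
qed

lemma powi_fib_rec:
  fixes a :: real
  assumes "a\<^sup>2 = a + 1"
  shows "a powi n = a powi (n - 1) + a powi (n - 2)"
proof -
  have a: "a \<noteq> 0" using assms by auto
  then have "a powi n = a powi (n - 2) * a\<^sup>2" "a powi (n - 1) = a powi (n - 2) * a"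
    using power_int_add[of a "n - 2" 2] power_int_add[of a "n - 2" 1] by simp_all
  then show ?thesis using assms by (simp add: algebra_simps)
qed

text \<open>Both sides obey the Fibonacci recurrence and agree at 0 and 1. Leaving open which root a
  is, and writing a - b for the signed square root of 5, allows use with the roots
  exchanged.\<close>

lemma binet:
  fixes a b :: real
  assumes "a\<^sup>2 = a + 1" and "b = 1 - a"
  shows "(a - b) * F n = a powi n - b powi n" and "L n = a powi n + b powi n"
proof -
  have "b\<^sup>2 = a\<^sup>2 - 2 * a + 1" unfolding assms(2) by (simp add: power2_eq_square algebra_simps)
  then have b: "b\<^sup>2 = b + 1" using assms by simp
  show "(a - b) * F n = a powi n - b powi n"
  proof (rule fib_recurrence_unique)
    show "(a - b) * F n = (a - b) * F (n - 1) + (a - b) * F (n - 2)" for n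
      by (subst fib_int_rec[of n]) (simp add: distrib_left)
    show "a powi n - b powi n = (a powi (n - 1) - b powi (n - 1)) + (a powi (n - 2) - b powi (n - 2))" for n
      using powi_fib_rec[OF assms(1), of n] powi_fib_rec[OF b, of n] by simp
  qed (simp_all add: fib_int_def)
  show "L n = a powi n + b powi n"
  proof (rule fib_recurrence_unique)
    show "L n = L (n - 1) + L (n - 2)" for n
      by (subst lucas_int_rec[of n]) simp
    show "a powi n + b powi n = (a powi (n - 1) + b powi (n - 1)) + (a powi (n - 2) + b powi (n - 2))" for n
      using powi_fib_rec[OF assms(1), of n] powi_fib_rec[OF b, of n] by simp
  qed (use assms in \<open>simp_all add: lucas_int_def\<close>)
qed

text \<open>The parameter e is 1 for Fibonacci weights and a square root of 5 for Lucas weights.\<close>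
lemma sum_weighted_choose_powi:
  fixes a b e :: real and x y p q t :: int
  assumes a: "a\<^sup>2 = a + 1" and b: "b = 1 - a" and e: "e \<noteq> 0"
    and d: "of_int x - b powi q * of_int y = e * a powi p * F q"
  defines "X \<equiv> real_of_int x" and "Y \<equiv> real_of_int y"
  shows "e * (\<Sum>k=1..n. (-1) powi (q * (int n - int k)) * (real k / real (n + k))
           * real ((n + k) choose (n - k)) * Y ^ (n - k) * X ^ (n - k)
           * F q ^ (2 * k - 1) * (e\<^sup>2) ^ (k - 1) * a powi ((2 * p + q) * int k + t))
    = (X ^ (2 * n) * (X * a powi (p + t + q * int n) + Y * a powi (q + p + t + q * int n))
       - Y ^ (2 * n) * (X * a powi (p + t - q * int n) + Y * a powi (q + p + t - q * int n)))
      / (2 * (X\<^sup>2 + Y * X * L q + (-1) powi q * Y\<^sup>2))"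
proof -
  define A where "A = a powi q"
  define B where "B = b powi q"
  have "a * b = a - a\<^sup>2" unfolding b by (simp add: power2_eq_square algebra_simps)
  then have ab: "a * b = -1" using a by simp
  have a0: "a \<noteq> 0" using ab by auto
  have AB: "A * B = (-1) powi q"
    unfolding A_def B_def ab[symmetric] by (simp add: power_int_mult_distrib)
  have AB2: "(A * B)\<^sup>2 = 1"
    unfolding AB by (simp add: power_int_def flip: power_mult power_inverse)
  have Lq: "L q = A + B" and Fq: "(a - b) * F q = A - B"
    using binet[OF a b] by (simp_all add: A_def B_def)
  have "(a - b)\<^sup>2 = 4 * a\<^sup>2 - 4 * a + 1" unfolding b by (simp add: power2_eq_square algebra_simps)
  then have s2: "(a - b)\<^sup>2 = 5" using a by simp
  have D: "X\<^sup>2 + Y * X * L q + (-1) powi q * Y\<^sup>2 = (X + A * Y) * (X + B * Y)"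
    unfolding Lq AB[symmetric] by (simp add: power2_eq_square algebra_simps)
  \<comment> \<open>Four times this product is (2 X + Y L q)^2 - 5 (F q)^2 Y^2, and 5 is not a rational square;
    so the junk value of division by zero only matters when both sides vanish.\<close>
  have D0: "F q = 0" if "(X + A * Y) * (X + B * Y) = 0"
  proof (rule ccontr)
    assume f: "F q \<noteq> 0"
    have "(2 * X + Y * L q)\<^sup>2 - ((a - b) * F q)\<^sup>2 * Y\<^sup>2 = 4 * ((X + A * Y) * (X + B * Y))"
      unfolding Lq Fq by (simp add: power2_eq_square algebra_simps)
    then have "(2 * X + Y * L q)\<^sup>2 = 5 * (F q * Y)\<^sup>2"
      using that by (simp add: power_mult_distrib s2)
    \<comment> \<open>Here the integrality of x and y matters: the equation descends from the reals
      to the integers.\<close>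
    then have "real_of_int ((2 * x + y * lucas_int q)\<^sup>2) = real_of_int (5 * (fib_int q * y)\<^sup>2)"
      unfolding X_def Y_def by simp
    then have "fib_int q * y = 0"
      using int_square_eq_5_square of_int_eq_iff by metis
    \<comment> \<open>With Y = 0 the vanishing product is X^2, so X = 0 as well. Then
      \<open>d\<close> reads 0 = e a^p F_q, whose right side is nonzero.\<close>
    with f have "Y = 0" by (simp add: Y_def)
    with that have "X = 0" by simp
    with d f e a0 \<open>Y = 0\<close> show False by (simp add: X_def Y_def)
  qed
  have sgn: "(-1) powi (q * (int n - int k)) = (A * B) ^ (n - k)" if "k \<in> {1..n}" for k
  proof -
    have "int n - int k = int (n - k)" using that by auto
    then show ?thesis unfolding AB by (simp only: power_int_mult power_int_of_nat)
  qed
  have a_sum: "a powi ((2 * p + q) * int k + t) = (a powi p) ^ (2 * k) * A ^ k * a powi t" for k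
  proof -
    have "(2 * p + q) * int k + t = p * int (2 * k) + q * int k + t" by (simp add: algebra_simps)
    then show ?thesis using a0 unfolding A_def by (simp only: power_int_add power_int_mult power_int_of_nat simp_thms)
  qed
  have a_idx: "a powi (p + t + q * int n) = a powi p * a powi t * A ^ n"
     "a powi (q + p + t + q * int n) = A * a powi p * a powi t * A ^ n"
     "a powi (p + t - q * int n) = a powi p * a powi t / A ^ n"
     "a powi (q + p + t - q * int n) = A * a powi p * a powi t / A ^ n"
    using a0 unfolding A_def by (simp_all add: power_int_add power_int_diff power_int_mult)
  have d': "X - B * Y = e * a powi p * F q" using d by (simp add: X_def Y_def B_def)
  show ?thesis
    unfolding a_sum a_idx D
    by (rule trans[OF _ sum_weighted_choose_power[OF AB2 d' e D0]])
      (auto intro!: arg_cong[where f = "(*) e"] sum.cong simp only: sgn)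
qed

section \<open>Combining the two conjugate versions\<close>

theorem theorem21:
  fixes n :: nat and p q t :: int
  assumes "n > 0"
  shows "(\<Sum>k=1..n. (-1) powi (q * (int n - int k)) * (real k / real (n + k))
           * real ((n + k) choose (n - k)) * F p ^ (n - k) * F (p + q) ^ (n - k)
           * F q ^ (2 * k - 1) * L ((2 * p + q) * int k + t))
         = (F (p + q) ^ (2 * n)
              * (F (p + q) * L (p + t + q * int n) + F p * L (q + p + t + q * int n))
            - F p ^ (2 * n)
              * (F (p + q) * L (p + t - q * int n) + F p * L (q + p + t - q * int n)))
           / (2 * (F (p + q) ^ 2 + F p * F (p + q) * L q + (-1) powi q * F p ^ 2))
    \<and> (\<Sum>k=1..n. (-1) powi (q * (int n - int k)) * (real k / real (n + k))
           * real ((n + k) choose (n - k)) * F p ^ (n - k) * F (p + q) ^ (n - k)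
           * F q ^ (2 * k - 1) * F ((2 * p + q) * int k + t))
         = (F (p + q) ^ (2 * n)
              * (F (p + q) * F (p + t + q * int n) + F p * F (q + p + t + q * int n))
            - F p ^ (2 * n)
              * (F (p + q) * F (p + t - q * int n) + F p * F (q + p + t - q * int n)))
           / (2 * (F (p + q) ^ 2 + F p * F (p + q) * L q + (-1) powi q * F p ^ 2))
    \<and> (\<Sum>k=1..n. (-1) powi (q * (int n - int k)) * (real k / real (n + k))
           * real ((n + k) choose (n - k)) * L p ^ (n - k) * L (p + q) ^ (n - k)
           * F q ^ (2 * k - 1) * 5 ^ k * F ((2 * p + q) * int k + t))
         = (L (p + q) ^ (2 * n)
              * (L (p + q) * L (p + t + q * int n) + L p * L (q + p + t + q * int n))
            - L p ^ (2 * n)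
              * (L (p + q) * L (p + t - q * int n) + L p * L (q + p + t - q * int n)))
           / (2 * (L (p + q) ^ 2 + L p * L (p + q) * L q + (-1) powi q * L p ^ 2))
    \<and> (\<Sum>k=1..n. (-1) powi (q * (int n - int k)) * (real k / real (n + k))
           * real ((n + k) choose (n - k)) * L p ^ (n - k) * L (p + q) ^ (n - k)
           * F q ^ (2 * k - 1) * 5 ^ (k - 1) * L ((2 * p + q) * int k + t))
         = (L (p + q) ^ (2 * n)
              * (L (p + q) * F (p + t + q * int n) + L p * F (q + p + t + q * int n))
            - L p ^ (2 * n)
              * (L (p + q) * F (p + t - q * int n) + L p * F (q + p + t - q * int n)))
           / (2 * (L (p + q) ^ 2 + L p * L (p + q) * L q + (-1) powi q * L p ^ 2))"
proof -
  define a b :: real where "a = (1 + sqrt 5) / 2" and "b = (1 - sqrt 5) / 2"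
  define s where "s = a - b"
  have a: "a\<^sup>2 = a + 1" and b: "b\<^sup>2 = b + 1" and ba: "b = 1 - a" and ab: "a = 1 - b"
    by (simp_all add: a_def b_def power2_eq_square field_simps)
  have s: "s = sqrt 5" by (simp add: s_def a_def b_def field_simps)
  then have s0: "s \<noteq> 0" and s2: "s\<^sup>2 = 5" by simp_all
  have F_binet: "F i = (a powi i - b powi i) / s" and L_binet: "L i = a powi i + b powi i" for i
    using binet[OF a ba, of i] s0 by (simp_all add: s_def field_simps)
  have ab0: "a \<noteq> 0" "b \<noteq> 0" using a b by auto
  \<comment> \<open>The constants 1, 1, s and -s are the values of e. Exchanging the roots changes
    the sign of s, hence the -s in \<open>L_b\<close>.\<close>
  have F_a: "F (p + q) - b powi q * F p = 1 * a powi p * F q"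
    and F_b: "F (p + q) - a powi q * F p = 1 * b powi p * F q"
    and L_a: "L (p + q) - b powi q * L p = s * a powi p * F q"
    and L_b: "L (p + q) - a powi q * L p = (- s) * b powi p * F q"
    using s0 ab0 by (simp_all add: F_binet L_binet power_int_add field_simps)
  have SL: "(\<Sum>k\<in>K. w k * L (m k)) = (\<Sum>k\<in>K. w k * a powi m k) + (\<Sum>k\<in>K. w k * b powi m k)"
    and SF: "(\<Sum>k\<in>K. w k * F (m k)) = ((\<Sum>k\<in>K. w k * a powi m k) - (\<Sum>k\<in>K. w k * b powi m k)) / s"
    for K and w :: "nat \<Rightarrow> real" and m
    by (simp_all add: F_binet L_binet sum_divide_distrib sum.distrib[symmetric] sum_subtractf[symmetric] algebra_simps diff_divide_distrib)
  note F_sum_a = sum_weighted_choose_powi[OF a ba one_neq_zero F_a, where n = n and t = t, simplified power_one mult_1 mult_1_right]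
  note F_sum_b = sum_weighted_choose_powi[OF b ab one_neq_zero F_b, where n = n and t = t, simplified power_one mult_1 mult_1_right]
  note L_sum_a = sum_weighted_choose_powi[OF a ba s0 L_a, where n = n and t = t, unfolded s2]
  have s0': "- s \<noteq> 0" and s2': "(- s)\<^sup>2 = 5" using s0 s2 by simp_all
  note L_sum_b = sum_weighted_choose_powi[OF b ab s0' L_b, where n = n and t = t, unfolded s2']
  \<comment> \<open>The right-hand sides are linear in their last Fibonacci or Lucas factors, so
    Binet's formula splits them just as \<open>SL\<close> and \<open>SF\<close> split the
    sums.\<close>
  have N_add: "(U * (X * (a1 + b1) + Y * (a2 + b2)) - V * (X * (a3 + b3) + Y * (a4 + b4))) / D
      = (U * (X * a1 + Y * a2) - V * (X * a3 + Y * a4)) / D + (U * (X * b1 + Y * b2) - V * (X * b3 + Y * b4)) / D"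
    and N_diff: "(U * (X * ((a1 - b1) / s) + Y * ((a2 - b2) / s)) - V * (X * ((a3 - b3) / s) + Y * ((a4 - b4) / s))) / D
      = ((U * (X * a1 + Y * a2) - V * (X * a3 + Y * a4)) / D - (U * (X * b1 + Y * b2) - V * (X * b3 + Y * b4)) / D) / s"
    for U V X Y D a1 a2 a3 a4 b1 b2 b3 b4 :: real
    unfolding divide_inverse by (simp_all only: algebra_simps)
  note L_ix = L_binet[of "p + t + q * int n"] L_binet[of "q + p + t + q * int n"]
    L_binet[of "p + t - q * int n"] L_binet[of "q + p + t - q * int n"]
  note F_ix = F_binet[of "p + t + q * int n"] F_binet[of "q + p + t + q * int n"]
    F_binet[of "p + t - q * int n"] F_binet[of "q + p + t - q * int n"]
  \<comment> \<open>For Lucas weights the two conjugate sums x and y arrive multiplied by s and -s.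
    Adding the right-hand sides therefore gives a difference of sums, which suits the Fibonacci
    summand, and subtracting them gives a sum, which suits the Lucas summand.\<close>
  have s_add: "x + y = (s * x - (- s) * y) / s" for x y
    using s0 by (simp flip: distrib_left)
  have s_diff: "5 * ((x - y) / s) = s * x + (- s) * y" for x y
  proof -
    have "5 * ((x - y) / s) = s * (x - y)"
      unfolding s2[symmetric] using s0 by (simp add: power2_eq_square)
    then show ?thesis by (simp add: right_diff_distrib)
  qed
  \<comment> \<open>The third formula carries 5^k where the general sum has (s^2)^(k-1). The extra
    factor 5 = s^2 is the one absorbed by \<open>s_diff\<close>.\<close>
  have five: "(\<Sum>k=1..n. w k * 5 ^ k * z k) = 5 * (\<Sum>k=1..n. w k * 5 ^ (k - 1) * z k)"
    for w z :: "nat \<Rightarrow> real"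
    unfolding sum_distrib_left
  proof (rule sum.cong[OF refl])
    fix k assume "k \<in> {1..n}"
    then have "(5::real) ^ k = 5 * 5 ^ (k - 1)" by (cases k) simp_all
    then show "w k * 5 ^ k * z k = 5 * (w k * 5 ^ (k - 1) * z k)" by simp
  qed
  show ?thesis
  proof (intro conjI)
    show "(\<Sum>k=1..n. (-1) powi (q * (int n - int k)) * (real k / real (n + k))
           * real ((n + k) choose (n - k)) * F p ^ (n - k) * F (p + q) ^ (n - k)
           * F q ^ (2 * k - 1) * L ((2 * p + q) * int k + t))
         = (F (p + q) ^ (2 * n)
              * (F (p + q) * L (p + t + q * int n) + F p * L (q + p + t + q * int n))
            - F p ^ (2 * n)
              * (F (p + q) * L (p + t - q * int n) + F p * L (q + p + t - q * int n)))
           / (2 * (F (p + q) ^ 2 + F p * F (p + q) * L q + (-1) powi q * F p ^ 2))"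
      unfolding L_ix N_add F_sum_a[symmetric] F_sum_b[symmetric] by (rule SL)
    show "(\<Sum>k=1..n. (-1) powi (q * (int n - int k)) * (real k / real (n + k))
           * real ((n + k) choose (n - k)) * F p ^ (n - k) * F (p + q) ^ (n - k)
           * F q ^ (2 * k - 1) * F ((2 * p + q) * int k + t))
         = (F (p + q) ^ (2 * n)
              * (F (p + q) * F (p + t + q * int n) + F p * F (q + p + t + q * int n))
            - F p ^ (2 * n)
              * (F (p + q) * F (p + t - q * int n) + F p * F (q + p + t - q * int n)))
           / (2 * (F (p + q) ^ 2 + F p * F (p + q) * L q + (-1) powi q * F p ^ 2))"
      unfolding F_ix N_diff F_sum_a[symmetric] F_sum_b[symmetric] by (rule SF)
    show "(\<Sum>k=1..n. (-1) powi (q * (int n - int k)) * (real k / real (n + k))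
           * real ((n + k) choose (n - k)) * L p ^ (n - k) * L (p + q) ^ (n - k)
           * F q ^ (2 * k - 1) * 5 ^ k * F ((2 * p + q) * int k + t))
         = (L (p + q) ^ (2 * n)
              * (L (p + q) * L (p + t + q * int n) + L p * L (q + p + t + q * int n))
            - L p ^ (2 * n)
              * (L (p + q) * L (p + t - q * int n) + L p * L (q + p + t - q * int n)))
           / (2 * (L (p + q) ^ 2 + L p * L (p + q) * L q + (-1) powi q * L p ^ 2))"
      unfolding L_ix N_add L_sum_a[symmetric] L_sum_b[symmetric] five unfolding SF by (rule s_diff)
    show "(\<Sum>k=1..n. (-1) powi (q * (int n - int k)) * (real k / real (n + k))
           * real ((n + k) choose (n - k)) * L p ^ (n - k) * L (p + q) ^ (n - k)
           * F q ^ (2 * k - 1) * 5 ^ (k - 1) * L ((2 * p + q) * int k + t))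
         = (L (p + q) ^ (2 * n)
              * (L (p + q) * F (p + t + q * int n) + L p * F (q + p + t + q * int n))
            - L p ^ (2 * n)
              * (L (p + q) * F (p + t - q * int n) + L p * F (q + p + t - q * int n)))
           / (2 * (L (p + q) ^ 2 + L p * L (p + q) * L q + (-1) powi q * L p ^ 2))"
      unfolding F_ix N_diff L_sum_a[symmetric] L_sum_b[symmetric] SL
      by (rule s_add)
  qed
qed

end
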